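(* For every admissible choice of the ball centers made during its execution, in the algorithm described in the context each term $\mathbf{x}_j$, $j\in\mathbb{N}$, changes only finitely many times (being redefined or becoming undefined), and the resulting sequence $\{\mathbf{x}_n\}_{n\in\mathbb{N}}\subseteq X$ of eventual values satisfies $\mathbf{x}_n\to\mathbf{s}$ as $n\to\infty$, i.e. $\rho(\mathbf{x}_n;\mathbf{s})\to0$.
   Context: Sound ranging problem (SRP). $(X;\rho)$ is a metric space, $B[\mathbf{c};r]=\{\mathbf{x}\in X\mid\rho(\mathbf{x};\mathbf{c})\leq r\}$, $B(\mathbf{c};r)=\{\mathbf{x}\in X\mid\rho(\mathbf{x};\mathbf{c})<r\}$, $\rho(\mathbf{x};A)=\inf_{\mathbf{u}\in A}\rho(\mathbf{x};\mathbf{u})$. $I$ is a nonempty index set, $\{\mathbf{r}_i\}_{i\in I}\subseteq X$ is a bounded indexed set of points (sensors), $\mathbf{s}\in X$ (the source) and $t_0\in\mathbb{R}$ are fixed, and $t_i=t_0+\rho(\mathbf{r}_i;\mathbf{s})$ for $i\in I$. A point $\mathbf{s}'\in X$ is a solution of the SRP $(\{\mathbf{r}_i\};\{t_i\})$ if there is $t'\in\mathbb{R}$ with $t_i=t'+\rho(\mathbf{r}_i;\mathbf{s}')$ for all $i\in I$. Standing assumption: $\mathbf{s}$ is the unique solution in $X$. Defect. For $\mathbf{x}\in X$, $\tau_i(\mathbf{x})=t_i-\rho(\mathbf{x};\mathbf{r}_i)$, and $D_\infty(\mathbf{x})=\sup_{i,j\in I}|\tau_i(\mathbf{x})-\tau_j(\mathbf{x})|$.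 If $I=\{1,\dots,n\}$ or $I=\mathbb{N}$, then also $D_1(\mathbf{x})=\sum_{i\in I}p_i\bigl|\tau_i(\mathbf{x})-\sum_{j\in I}p_j\tau_j(\mathbf{x})\bigr|$, where $\{p_i\}_{i\in I}$ is a fixed family with $p_i>0$, $\sum_{i\in I}p_i=1$. $D$ denotes either $D_\infty$ or $D_1$ (the latter only when it is defined), the same choice for all $\mathbf{x}$. SDN property. $A\subseteq X$ has the SDN property if: $\mathbf{s}\in A$ implies that for every $\delta>0$, $\inf_{\mathbf{x}\in A\setminus B(\mathbf{s};\delta)}D(\mathbf{x})>0$ (with $\inf\varnothing=+\infty$). Assumptions. $\{K_n\}_{n\in\mathbb{N}}$ is a known sequence of nonempty compact subsets of $X$ with $\rho(\mathbf{s};K_n)\to0$ as $n\to\infty$; and $\bigcup_{n\in\mathbb{N}}K_n\subseteq A$, $\mathbf{s}\in A$, $\operatorname{diam}A\leq r$, where $A\subseteq X$ has the SDN property and $r>0$ is known. Covers. A family $\{C_j\}_{j\in J}$ of subsets of $X$ is an $\varepsilon$-neighborhood-cover of $K\subseteq X$ if every $\mathbf{x}\in X$ with $\rho(\mathbf{x};K)\leq\varepsilon$ belongs to some $C_j$. For $n,k\in\mathbb{N}=\{1,2,\dots\}$ let $r_k=\frac{r}{2^{k-1}}$ and let $\mathfrak{C}_{n,k}=\{B[\mathbf{c}^{(n)}_{k,j};r_k]\}_{j=1}^{m_{n,k}}$ be a finite $\frac{r}{2^k}$-neighborhood-cover of $K_n$ with $\mathbf{c}^{(n)}_{k,j}\in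 K_n$ (such covers exist). Let $\mathfrak{S}_{n,k}=\{B[\mathbf{c};r_k]\in\mathfrak{C}_{n,k}\mid D(\mathbf{c})\leq2r_k\}$ (balls are recorded with their centers). Let $\mu_n=\min\{k\in\mathbb{N}\mid\mathfrak{S}_{n,k+1}=\varnothing\}$, with $\mu_n=\infty$ if there is no such $k$. Algorithm. Start with $n=1$. At stage $n$: for $k=1,2,\dots$ consecutively, let $\mathbf{x}_{n-1+k}$ be the center of an arbitrarily chosen ball from $\mathfrak{S}_{n,k}$, until $\mathfrak{S}_{n,k}=\varnothing$ (i.e. $k=\mu_n+1$), or eternally if $\mu_n=\infty$. If $\mu_n<\infty$, then upon reaching $k=\mu_n+1$ let $\mathbf{x}_n:=\mathbf{x}_{n-1+\mu_n}$ (the center of a ball from $\mathfrak{S}_{n,\mu_n}$), discard $\mathbf{x}_{n+1},\dots,\mathbf{x}_{n-1+\mu_n}$, increment $n:=n+1$, and start the next stage. The algorithm never halts. Thus, with $\nu=\min\{n\mid\mu_n=\infty\}$ ($\nu=\infty$ if there is no such $n$), the eventual value of $\mathbf{x}_n$ for $n<\nu$ is the center of a ball from $\mathfrak{S}_{n,\mu_n}$, and, if $\nu<\infty$, the eventual value of $\mathbf{x}_{\nu-1+k}$, $k\in\mathbb{N}$, is the center of a ball from $\mathfrak{S}_{\nu,k}$. *)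

theory Defs
  imports "HOL-Analysis.Analysis"
begin

text \<open>The metric space is the type \<open>'a\<close>. Index sets written as \<open>{1, 2, ...}\<close> are rendered by
  \<^typ>\<open>nat\<close> with the guard \<open>1 \<le> n\<close>; values at index 0 are irrelevant.\<close>

definition srp_time :: "('i \<Rightarrow> 'a::metric_space) \<Rightarrow> 'a \<Rightarrow> real \<Rightarrow> 'i \<Rightarrow> real" where
  "srp_time sensor s t0 i = t0 + dist (sensor i) s"

definition srp_solution :: "'i set \<Rightarrow> ('i \<Rightarrow> 'a::metric_space) \<Rightarrow> ('i \<Rightarrow> real) \<Rightarrow> 'a \<Rightarrow> bool" where
  "srp_solution I sensor t s' \<longleftrightarrow> (\<exists>t'. \<forall>i\<in>I. t i = t' + dist (sensor i) s')"

definition tau :: "('i \<Rightarrow> 'a::metric_space) \<Rightarrow> ('i \<Rightarrow> real) \<Rightarrow> 'a \<Rightarrow> 'i \<Rightarrow> real" where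
  "tau sensor t x i = t i - dist x (sensor i)"

text \<open>For \<open>t = srp_time sensor s t0\<close> one has \<open>\<bar>tau sensor t x i - t0\<bar> \<le> dist x s\<close>, so for nonempty
  \<open>I\<close> the real supremum and the unconditional sums below are the genuine ones.\<close>

definition D_infty :: "'i set \<Rightarrow> ('i \<Rightarrow> 'a::metric_space) \<Rightarrow> ('i \<Rightarrow> real) \<Rightarrow> 'a \<Rightarrow> real" where
  "D_infty I sensor t x = (SUP (i, j)\<in>I \<times> I. \<bar>tau sensor t x i - tau sensor t x j\<bar>)"

definition D_one ::
  "'i set \<Rightarrow> ('i \<Rightarrow> real) \<Rightarrow> ('i \<Rightarrow> 'a::metric_space) \<Rightarrow> ('i \<Rightarrow> real) \<Rightarrow> 'a \<Rightarrow> real" where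
  "D_one I p sensor t x =
    (\<Sum>\<^sub>\<infinity>i\<in>I. p i * \<bar>tau sensor t x i - (\<Sum>\<^sub>\<infinity>j\<in>I. p j * tau sensor t x j)\<bar>)"

text \<open>The second alternative needs a finite or countably infinite sensor family; \<open>countable I\<close>
  expresses this without fixing the labels \<open>1, ..., n\<close> or \<open>1, 2, ...\<close>.\<close>

definition is_defect ::
  "'i set \<Rightarrow> ('i \<Rightarrow> 'a::metric_space) \<Rightarrow> ('i \<Rightarrow> real) \<Rightarrow> ('a \<Rightarrow> real) \<Rightarrow> bool" where
  "is_defect I sensor t D \<longleftrightarrow>
    D = D_infty I sensor t \<or>
    countable I \<and> (\<exists>p. (\<forall>i\<in>I. 0 < p i) \<and> (p has_sum 1) I \<and> D = D_one I p sensor t)"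

text \<open>The infimum is taken in \<^typ>\<open>ereal\<close>, so that it is \<open>\<infinity>\<close> over the empty set.\<close>

definition SDN :: "('a::metric_space \<Rightarrow> real) \<Rightarrow> 'a \<Rightarrow> 'a set \<Rightarrow> bool" where
  "SDN D s A \<longleftrightarrow> (s \<in> A \<longrightarrow> (\<forall>\<delta>>0. (INF x\<in>A - ball s \<delta>. ereal (D x)) > 0))"

definition neighborhood_cover ::
  "real \<Rightarrow> 'a::metric_space set \<Rightarrow> 'j set \<Rightarrow> ('j \<Rightarrow> 'a set) \<Rightarrow> bool" where
  "neighborhood_cover \<epsilon> K J C \<longleftrightarrow> (\<forall>x. infdist x K \<le> \<epsilon> \<longrightarrow> (\<exists>j\<in>J. x \<in> C j))"

definition radius :: "real \<Rightarrow> nat \<Rightarrow> real" where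
  "radius r k = r / 2 ^ (k - 1)"

text \<open>Balls are recorded by their centers: all balls with indices \<open>n, k\<close> have radius
  \<open>radius r k\<close>.\<close>

definition selected ::
  "('a \<Rightarrow> real) \<Rightarrow> real \<Rightarrow> (nat \<Rightarrow> nat \<Rightarrow> nat) \<Rightarrow> (nat \<Rightarrow> nat \<Rightarrow> nat \<Rightarrow> 'a) \<Rightarrow> nat \<Rightarrow> nat \<Rightarrow> 'a set" where
  "selected D r m c n k = {c n k j | j. j \<in> {1..m n k} \<and> D (c n k j) \<le> 2 * radius r k}"

text \<open>A state \<open>(n, k, x)\<close> consists of the stage \<open>n\<close>, the counter \<open>k\<close> within the stage and the
  current terms, where \<open>x j = None\<close> means that the \<open>j\<close>-th term is undefined. Let \<open>\<mu>\<close> be the least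
  \<open>k \<ge> 1\<close> with \<open>S n (k + 1) = {}\<close>. Rule \<open>close\<close> fires when \<open>k = \<mu> + 1\<close>; since
  \<open>D y \<le> 2 * dist y s\<close>, the set \<open>S n 1\<close> is nonempty under the hypotheses of the theorem, so the rule
  is never applied with \<open>k = 1\<close>.\<close>

type_synonym 'a alg_state = "nat \<times> nat \<times> (nat \<Rightarrow> 'a option)"

inductive alg_step :: "(nat \<Rightarrow> nat \<Rightarrow> 'a set) \<Rightarrow> 'a alg_state \<Rightarrow> 'a alg_state \<Rightarrow> bool"
  for S where
  choose: "y \<in> S n k \<Longrightarrow> alg_step S (n, k, x) (n, k + 1, x(n - 1 + k := Some y))"
| close: "S n k = {} \<Longrightarrow>
    alg_step S (n, k, x)
      (n + 1, 1, \<lambda>j. if j = n then x (n - 1 + (k - 1))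
                     else if n + 1 \<le> j \<and> j \<le> n - 1 + (k - 1) then None
                     else x j)"

definition alg_run :: "(nat \<Rightarrow> nat \<Rightarrow> 'a set) \<Rightarrow> (nat \<Rightarrow> 'a alg_state) \<Rightarrow> bool" where
  "alg_run S R \<longleftrightarrow> R 0 = (1, 1, \<lambda>_. None) \<and> (\<forall>i. alg_step S (R i) (R (Suc i)))"

definition alg_term :: "(nat \<Rightarrow> 'a alg_state) \<Rightarrow> nat \<Rightarrow> nat \<Rightarrow> 'a option" where
  "alg_term R i j = snd (snd (R i)) j"

lemma alg_step_total: "\<exists>st'. alg_step S st st'"
proof -
  obtain n k x where "st = (n, k, x)" by (cases st)
  then show ?thesis
    using alg_step.choose[of _ S n k x] alg_step.close[of S n k x] by (cases "S n k = {}") blast+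
qed

end

theory Submission
  imports Defs
begin

text \<open>The defect satisfies \<open>D y \<le> 2 * dist y s\<close>, so a ball of the \<open>k\<close>-th cover of \<open>K n\<close> that contains
  \<open>s\<close> is selected; such a ball exists as soon as \<open>infdist s (K n) \<le> r / 2 ^ k\<close>. Hence the depth reached
  in stage \<open>n\<close> tends to infinity with \<open>n\<close>, unless some stage is infinite. In either case the eventual
  terms are centers of balls selected at unbounded depths, so their defects tend to 0, and the SDN
  property forces convergence to \<open>s\<close>.\<close>

section \<open>Upper bound for the defect\<close>

text \<open>The weights sum to 1, so a constant is its own weighted mean, and termwise comparison
  with the constants \<open>a\<close> and \<open>b\<close> suffices. Domination by
  \<open>p i * max \<bar>a\<bar> \<bar>b\<bar>\<close> gives summability first, so that
  \<open>infsum\<close> is a genuine sum and not the default 0.\<close>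

lemma infsum_weighted_mean_bounds:
  fixes p f :: "'i \<Rightarrow> real"
  assumes p: "(p has_sum 1) I" and p_nonneg: "\<And>i. i \<in> I \<Longrightarrow> 0 \<le> p i"
    and f: "\<And>i. i \<in> I \<Longrightarrow> a \<le> f i" "\<And>i. i \<in> I \<Longrightarrow> f i \<le> b"
  shows "a \<le> (\<Sum>\<^sub>\<infinity>i\<in>I. p i * f i)" and "(\<Sum>\<^sub>\<infinity>i\<in>I. p i * f i) \<le> b"
proof -
  have const: "((\<lambda>i. p i * u) has_sum u) I" for u
    using has_sum_cmult_left[OF p, of u] by simp
  have "(\<lambda>i. norm (p i * f i)) summable_on I"
  proof (rule Infinite_Sum.abs_summable_on_comparison_test')
    show "(\<lambda>i. p i * max \<bar>a\<bar> \<bar>b\<bar>) summable_on I"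
      using const by (rule has_sum_imp_summable)
    show "norm (p i * f i) \<le> p i * max \<bar>a\<bar> \<bar>b\<bar>" if "i \<in> I" for i
    proof -
      have "\<bar>f i\<bar> \<le> max \<bar>a\<bar> \<bar>b\<bar>"
        using f[OF that] by linarith
      then show ?thesis
        using p_nonneg[OF that] by (simp add: abs_mult mult_left_mono)
    qed
  qed
  then have mean: "((\<lambda>i. p i * f i) has_sum (\<Sum>\<^sub>\<infinity>i\<in>I. p i * f i)) I"
    by (rule has_sum_infsum[OF Infinite_Sum.abs_summable_summable])
  show "a \<le> (\<Sum>\<^sub>\<infinity>i\<in>I. p i * f i)"
    by (rule has_sum_mono[OF const[of a] mean]) (simp add: f p_nonneg mult_left_mono)
  show "(\<Sum>\<^sub>\<infinity>i\<in>I. p i * f i) \<le> b"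
    by (rule has_sum_mono[OF mean const[of b]]) (simp add: f p_nonneg mult_left_mono)
qed

lemma abs_tau_diff_le: "\<bar>tau sensor (srp_time sensor s t0) x i - t0\<bar> \<le> dist x s"
proof -
  have "\<bar>dist s (sensor i) - dist x (sensor i)\<bar> \<le> dist s x"
    using dist_triangle[of s "sensor i" x] dist_triangle[of x "sensor i" s]
    by (simp add: dist_commute abs_le_iff)
  then show ?thesis
    by (simp add: tau_def srp_time_def dist_commute)
qed

text \<open>All values \<open>tau\<close> at \<open>x\<close> lie in the interval of radius
  \<open>dist x s\<close> around \<open>t0\<close>, and so does each of their weighted means. Two
  points of this interval differ by at most its length.\<close>

lemma defect_le:
  assumes "I \<noteq> {}" and "is_defect I sensor (srp_time sensor s t0) D"
  shows "D x \<le> 2 * dist x s"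
proof -
  define T where "T = tau sensor (srp_time sensor s t0) x"
  have T: "\<bar>T i - t0\<bar> \<le> dist x s" for i
    unfolding T_def by (rule abs_tau_diff_le)
  then have T': "t0 - dist x s \<le> T i" "T i \<le> t0 + dist x s" for i
    by (simp_all add: abs_le_iff algebra_simps)
  from assms(2) consider "D = D_infty I sensor (srp_time sensor s t0)"
    | p where "\<forall>i\<in>I. 0 < p i" "(p has_sum 1) I" "D = D_one I p sensor (srp_time sensor s t0)"
    unfolding is_defect_def by blast
  then show ?thesis
  proof cases
    case 1
    have "(SUP (i, j)\<in>I \<times> I. \<bar>T i - T j\<bar>) \<le> 2 * dist x s"
    \<comment> \<open>A supremum of reals is bounded this way only over a nonempty set; here
      \<open>I \<noteq> {}\<close> enters.\<close>
    proof (rule cSUP_least, use assms(1) in simp)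
      fix ij assume "ij \<in> I \<times> I"
      show "(case ij of (i, j) \<Rightarrow> \<bar>T i - T j\<bar>) \<le> 2 * dist x s"
        using T'[of "fst ij"] T'[of "snd ij"] by (auto simp: case_prod_beta)
    qed
    with 1 show ?thesis by (simp add: D_infty_def T_def)
  next
    case 2
    define M where "M = (\<Sum>\<^sub>\<infinity>j\<in>I. p j * T j)"
    have p: "0 \<le> p i" if "i \<in> I" for i
      using 2(1) that by (simp add: less_imp_le)
    have M: "t0 - dist x s \<le> M" "M \<le> t0 + dist x s"
      unfolding M_def by (rule infsum_weighted_mean_bounds[OF 2(2) p T']; assumption)+
    have "(\<Sum>\<^sub>\<infinity>i\<in>I. p i * \<bar>T i - M\<bar>) \<le> 2 * dist x s"
    proof (rule infsum_weighted_mean_bounds(2)[OF 2(2) p])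
      show "0 \<le> \<bar>T i - M\<bar>" for i by simp
      show "\<bar>T i - M\<bar> \<le> 2 * dist x s" for i
        using T'[of i] M by linarith
    qed
    with 2(3) show ?thesis by (simp add: D_one_def M_def T_def)
  qed
qed

section \<open>Convergence from the SDN property\<close>

text \<open>On \<open>A\<close> outside a ball around \<open>s\<close> the defect stays above a
  positive constant, so points of \<open>A\<close> with smaller defect must lie in the ball.\<close>

lemma SDN_imp_tendsto:
  assumes "SDN D s A" and "s \<in> A" and x: "\<forall>\<^sub>F n in F. x n \<in> A"
    and D: "\<And>\<epsilon>. 0 < \<epsilon> \<Longrightarrow> \<forall>\<^sub>F n in F. D (x n) < \<epsilon>"
  shows "(x \<longlongrightarrow> s) F"
proof (rule tendstoI)
  fix \<delta> :: real assume "0 < \<delta>"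
  then have "0 < (INF x\<in>A - ball s \<delta>. ereal (D x))"
    using assms(1,2) by (simp add: SDN_def)
  \<comment> \<open>The infimum is \<infinity> if \<open>A\<close> lies inside the ball, so a real
    number strictly below it is taken.\<close>
  then obtain \<epsilon> where \<epsilon>: "0 < ereal \<epsilon>" "ereal \<epsilon> < (INF x\<in>A - ball s \<delta>. ereal (D x))"
    using ereal_dense2 by blast
  have far: "\<epsilon> < D y" if "y \<in> A - ball s \<delta>" for y
  proof -
    have "ereal \<epsilon> < ereal (D y)"
      using \<epsilon>(2) that by (meson INF_lower less_le_trans)
    then show ?thesis by simp
  qed
  from x D[of \<epsilon>] \<epsilon>(1) have "\<forall>\<^sub>F n in F. x n \<in> A \<and> D (x n) < \<epsilon>"
    by (simp add: eventually_conj)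
  then show "\<forall>\<^sub>F n in F. dist (x n) s < \<delta>"
  proof eventually_elim
    case (elim n)
    with far[of "x n"] show ?case by (auto simp: dist_commute)
  qed
qed

section \<open>Invariants of a run\<close>

definition closing_center :: "(nat \<Rightarrow> nat \<Rightarrow> 'a set) \<Rightarrow> nat \<Rightarrow> 'a \<Rightarrow> bool" where
  "closing_center S n y \<longleftrightarrow> (\<exists>k\<ge>1. y \<in> S n k \<and> S n (k + 1) = {})"

text \<open>The terms of the running stage, which \<open>close\<close> may still overwrite or
  discard, are kept apart from those left by finished stages, which are final.\<close>

definition run_inv :: "(nat \<Rightarrow> nat \<Rightarrow> 'a set) \<Rightarrow> 'a alg_state \<Rightarrow> bool" where
  "run_inv S = (\<lambda>(n, k, x). 1 \<le> n \<and> 1 \<le> k \<and>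
    (\<forall>l. 1 \<le> l \<and> l < k \<longrightarrow> (\<exists>y\<in>S n l. x (n - 1 + l) = Some y)) \<and>
    (\<forall>j. 1 \<le> j \<and> j < n \<longrightarrow> (\<exists>y. closing_center S j y \<and> x j = Some y)))"

lemma run_inv_step:
  assumes "alg_step S st st'" and "run_inv S st" and S1: "\<And>n. 1 \<le> n \<Longrightarrow> S n 1 \<noteq> {}"
  shows "run_inv S st'"
  using assms(1)
proof cases
  case (choose y n k x)
  have inv: "1 \<le> n" "1 \<le> k" "\<And>l. 1 \<le> l \<Longrightarrow> l < k \<Longrightarrow> \<exists>y\<in>S n l. x (n - 1 + l) = Some y"
    "\<And>j. 1 \<le> j \<Longrightarrow> j < n \<Longrightarrow> \<exists>y. closing_center S j y \<and> x j = Some y"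
    using assms(2) choose(1) by (auto simp: run_inv_def)
  show ?thesis
    using inv(1,2,4) choose(3) inv(3) unfolding choose(2) run_inv_def
    by (auto simp: less_Suc_eq)
next
  case (close n k x)
  have inv: "1 \<le> n" "1 \<le> k" "\<And>l. 1 \<le> l \<Longrightarrow> l < k \<Longrightarrow> \<exists>y\<in>S n l. x (n - 1 + l) = Some y"
    "\<And>j. 1 \<le> j \<Longrightarrow> j < n \<Longrightarrow> \<exists>y. closing_center S j y \<and> x j = Some y"
    using assms(2) close(1) by (auto simp: run_inv_def)
  \<comment> \<open>With \<open>k = 1\<close>, closing would copy term \<open>n - 1\<close> into
    term \<open>n\<close> instead of a center from stage \<open>n\<close>.\<close>
  have "k \<noteq> 1"
    using S1[OF inv(1)] close(3) by auto
  with inv(2) have k: "1 \<le> k - 1" "k - 1 < k" "k - 1 + 1 = k"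
    by auto
  obtain y where y: "y \<in> S n (k - 1)" "x (n - 1 + (k - 1)) = Some y"
    using inv(3)[OF k(1,2)] by blast
  have "closing_center S n y"
    unfolding closing_center_def using k(1,3) y(1) close(3) by metis
  with y(2) inv(1,4) show ?thesis
    unfolding close(2) run_inv_def by (auto simp: less_Suc_eq)
qed

lemma run_inv_run:
  assumes "alg_run S R" and "\<And>n. 1 \<le> n \<Longrightarrow> S n 1 \<noteq> {}"
  shows "run_inv S (R i)"
proof (induction i)
  case 0
  then show ?case using assms(1) by (simp add: alg_run_def run_inv_def)
next
  case (Suc i)
  then show ?case using assms run_inv_step by (metis alg_run_def)
qed

section \<open>Stability and eventual values of the terms\<close>

text \<open>\<open>choose\<close> writes at index \<open>n - 1 + k\<close>, which is at least
  \<open>n\<close> because the invariant gives \<open>1 \<le> k\<close>; \<open>close\<close> alters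
  only indices from \<open>n\<close> on.\<close>

lemma alg_step_frozen:
  assumes "alg_step S st st'" and "run_inv S st" and "j < fst st"
  shows "snd (snd st') j = snd (snd st) j"
  using assms by cases (auto simp: run_inv_def)

lemma alg_step_stage_mono: "alg_step S st st' \<Longrightarrow> fst st \<le> fst st'"
  by (cases rule: alg_step.cases) auto

text \<open>\<open>close\<close> increments the stage, so a step that keeps it is
  \<open>choose\<close>.\<close>

lemma alg_step_same_stage:
  assumes "alg_step S st st'" and "fst st' = fst st"
  shows "fst (snd st') = fst (snd st) + 1"
    and "j \<noteq> fst st - 1 + fst (snd st) \<Longrightarrow> snd (snd st') j = snd (snd st) j"
  using assms by (cases; auto)+

text \<open>A term is final once its index is below the current stage, or once the current stage is the
  last one and has passed its index.\<close>

lemma alg_run_limit: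
  assumes run: "alg_run S R" and S1: "\<And>n. 1 \<le> n \<Longrightarrow> S n 1 \<noteq> {}"
    and S_ev: "\<And>k. 1 \<le> k \<Longrightarrow> \<forall>\<^sub>F n in sequentially. S n k \<noteq> {}"
  obtains x where "\<And>j. 1 \<le> j \<Longrightarrow> \<forall>\<^sub>F i in sequentially. alg_term R i j = Some (x j)"
    and "\<And>k. \<forall>\<^sub>F j in sequentially. \<exists>n\<ge>1. \<exists>l\<ge>k. 1 \<le> l \<and> x j \<in> S n l"
proof -
  define N where "N i = fst (R i)" for i
  define k where "k i = fst (snd (R i))" for i
  have R: "R i = (N i, k i, alg_term R i)" for i
    by (simp add: N_def k_def alg_term_def[abs_def])
  have step: "alg_step S (R i) (R (Suc i))" for i
    using run by (simp add: alg_run_def)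
  have inv: "run_inv S (R i)" for i
    using run S1 by (rule run_inv_run)
  have inv_pos: "1 \<le> N i" "1 \<le> k i" for i
    using inv[of i] unfolding R[of i] run_inv_def by auto
  have inv_old: "\<exists>y. closing_center S j y \<and> alg_term R i j = Some y" if "1 \<le> j" "j < N i" for i j
    using that inv[of i] unfolding R[of i] run_inv_def by auto
  have inv_cur: "\<exists>y\<in>S (N i) l. alg_term R i (N i - 1 + l) = Some y" if "1 \<le> l" "l < k i" for i l
    using that inv[of i] unfolding R[of i] run_inv_def by auto
  have N_mono: "mono N"
    using alg_step_stage_mono[OF step] by (simp add: N_def mono_iff_le_Suc)
  have old_const: "alg_term R (i + d) j = alg_term R i j" if "j < N i" for i d j
  proof (induction d)
    case (Suc d)
    have "j < N (i + d)"
      using that monoD[OF N_mono, of i "i + d"] by simp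
    then show ?case
      using Suc alg_step_frozen[OF step inv, of j "i + d"] by (simp add: N_def alg_term_def)
  qed simp
  \<comment> \<open>Closing at depth \<open>l\<close> requires \<open>S j (l + 1) = {}\<close>. Once
    the selections at depths 1 to \<open>k\<close> of stage \<open>j\<close> are nonempty, this
    forces \<open>l + 1 > k\<close>.\<close>
  have deep: "\<forall>\<^sub>F j in sequentially. \<forall>y. closing_center S j y \<longrightarrow> (\<exists>l\<ge>k. 1 \<le> l \<and> y \<in> S j l)" for k
  proof -
    have "\<forall>\<^sub>F j in sequentially. \<forall>l\<in>{1..k}. S j l \<noteq> {}"
      using S_ev by (intro eventually_ball_finite) auto
    then show ?thesis
    proof eventually_elim
      case (elim j)
      show ?case
      proof (intro allI impI)
        fix y assume "closing_center S j y"
        then obtain l where l: "1 \<le> l" "y \<in> S j l" "S j (l + 1) = {}"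
          unfolding closing_center_def by blast
        from elim l(1,3) have "k \<le> l"
          by (cases "k \<le> l") auto
        with l show "\<exists>l\<ge>k. 1 \<le> l \<and> y \<in> S j l" by blast
      qed
    qed
  qed
  have evI: "\<forall>\<^sub>F i in sequentially. P i" if "\<And>d. P (i + d)" for P and i :: nat
    using that unfolding eventually_sequentially by (metis le_add_diff_inverse)
  have final: "\<forall>\<^sub>F i in sequentially. alg_term R i j = Some y"
    if "j < N i" "alg_term R i j = Some y" for i j y
    by (rule evI[where i = i]) (simp add: old_const that)
  show ?thesis
  \<comment> \<open>Either the stages are unbounded and every term is left by a finished stage, or a
    last stage runs forever.\<close>
  proof (cases "\<forall>j. \<exists>i. j < N i")
    case True
    have "\<exists>y. closing_center S j y \<and> (\<forall>\<^sub>F i in sequentially. alg_term R i j = Some y)" if "1 \<le> j" for j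
    proof -
      from True obtain i where "j < N i" by blast
      with inv_old[OF that this] show ?thesis
        using final by blast
    qed
    then obtain x where x: "\<And>j. 1 \<le> j \<Longrightarrow> closing_center S j (x j)"
      "\<And>j. 1 \<le> j \<Longrightarrow> \<forall>\<^sub>F i in sequentially. alg_term R i j = Some (x j)"
      by metis
    have "\<forall>\<^sub>F j in sequentially. \<exists>n\<ge>1. \<exists>l\<ge>k. 1 \<le> l \<and> x j \<in> S n l" for k
      using deep[of k] eventually_ge_at_top[of 1] by eventually_elim (use x(1) in blast)
    with x(2) show ?thesis by (rule that)
  next
    case False
    then obtain B where B: "\<And>i. N i \<le> B"
      by (meson not_less)
    have fin: "finite (range N)"
      by (rule finite_subset[of _ "{..B}"]) (use B in auto)
    \<comment> \<open>By monotonicity the stage stays at its maximum from time \<open>i0\<close>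
      on.\<close>
    obtain i0 where i0: "N i0 = Max (range N)"
      using Max_in[OF fin] by auto
    have N_const: "N (i0 + d) = N i0" for d
      using monoD[OF N_mono, of i0 "i0 + d"] Max_ge[OF fin, of "N (i0 + d)"] i0 by auto
    have same: "fst (R (Suc (i0 + d))) = fst (R (i0 + d))" for d
      using N_const[of d] N_const[of "Suc d"] by (simp add: N_def)
    have k_eq: "k (i0 + d) = k i0 + d" for d
      by (induction d) (use alg_step_same_stage(1)[OF step same] in \<open>auto simp: k_def\<close>)
    \<comment> \<open>At time \<open>i0 + l + d\<close> the counter is \<open>k i0 + l + d\<close>,
      which exceeds \<open>l\<close>, so later writes go to larger indices.\<close>
    have cur_const: "alg_term R (i0 + l + d) (N i0 - 1 + l) = alg_term R (i0 + l) (N i0 - 1 + l)" for l d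
    proof (induction d)
      case (Suc d)
      have "N i0 - 1 + l \<noteq> fst (R (i0 + (l + d))) - 1 + fst (snd (R (i0 + (l + d))))"
        using k_eq[of "l + d"] N_const[of "l + d"] inv_pos[of i0] by (simp add: N_def k_def)
      from alg_step_same_stage(2)[OF step same this] Suc show ?case
        by (simp add: alg_term_def add.assoc)
    qed simp
    \<comment> \<open>Depth \<open>j + 1 - N i0\<close> inverts the index formula
      \<open>N i0 - 1 + l\<close>; the guard \<open>N i0 \<le> j\<close> keeps the subtraction from
      truncating.\<close>
    have "\<exists>y. (\<forall>\<^sub>F i in sequentially. alg_term R i j = Some y) \<and>
        (N i0 \<le> j \<longrightarrow> y \<in> S (N i0) (j + 1 - N i0))" if "1 \<le> j" for j
    proof (cases "j < N i0")
      case True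
      with inv_old[OF that this] show ?thesis
        using final by (meson not_less)
    next
      case False
      define l where "l = j + 1 - N i0"
      \<comment> \<open>The counter is at least 1 at time \<open>i0\<close> and grows by 1 per step,
        so it has passed \<open>l\<close> at time \<open>i0 + l\<close>.\<close>
      have l: "1 \<le> l" "j = N i0 - 1 + l" "l < k (i0 + l)"
        using False inv_pos[of i0] k_eq[of l] by (auto simp: l_def)
      obtain y where y: "y \<in> S (N i0) l" "alg_term R (i0 + l) j = Some y"
        using inv_cur[OF l(1,3)] N_const[of l] l(2) by auto
      have "alg_term R (i0 + l + d) j = Some y" for d
        using cur_const[of l d] l(2) y(2) by simp
      then have "\<forall>\<^sub>F i in sequentially. alg_term R i j = Some y"
        by (rule evI)
      with y(1) show ?thesis unfolding l_def by blast
    qed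
    then obtain x where x: "\<And>j. 1 \<le> j \<Longrightarrow> \<forall>\<^sub>F i in sequentially. alg_term R i j = Some (x j)"
      "\<And>j. 1 \<le> j \<Longrightarrow> N i0 \<le> j \<Longrightarrow> x j \<in> S (N i0) (j + 1 - N i0)"
      by metis
    have "\<forall>\<^sub>F j in sequentially. \<exists>n\<ge>1. \<exists>l\<ge>k. 1 \<le> l \<and> x j \<in> S n l" for k
      using eventually_ge_at_top[of "N i0 + k"]
    proof eventually_elim
      case (elim j)
      then have "x j \<in> S (N i0) (j + 1 - N i0)" "k \<le> j + 1 - N i0" "1 \<le> j + 1 - N i0"
        using x(2)[of j] inv_pos(1)[of i0] by auto
      with inv_pos(1)[of i0] show ?case by blast
    qed
    with x(1) show ?thesis by (rule that)
  qed
qed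

section \<open>Finitely many changes and convergence to the source\<close>

lemma finite_changes_if_eventually_const:
  assumes "\<forall>\<^sub>F i in sequentially. f i = y"
  shows "finite {i. f (Suc i) \<noteq> f i}"
proof -
  obtain n where n: "\<And>i. n \<le> i \<Longrightarrow> f i = y"
    using assms by (auto simp: eventually_sequentially)
  have "i < n" if "f (Suc i) \<noteq> f i" for i
    by (rule ccontr) (use n[of i] n[of "Suc i"] that in simp)
  then have "{i. f (Suc i) \<noteq> f i} \<subseteq> {..<n}"
    by blast
  then show ?thesis
    by (rule finite_subset) simp
qed

theorem mainTheorem3:
  fixes I :: "'i set"
    and sensor :: "'i \<Rightarrow> 'a::metric_space"
    and s :: 'a
    and t0 r :: real
    and D :: "'a \<Rightarrow> real"
    and K :: "nat \<Rightarrow> 'a set"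
    and A :: "'a set"
    and m :: "nat \<Rightarrow> nat \<Rightarrow> nat"
    and c :: "nat \<Rightarrow> nat \<Rightarrow> nat \<Rightarrow> 'a"
    and R :: "nat \<Rightarrow> 'a alg_state"
  assumes "I \<noteq> {}"
    and "bounded (sensor ` I)"
    and "\<And>x. srp_solution I sensor (srp_time sensor s t0) x \<longleftrightarrow> x = s"
    and "is_defect I sensor (srp_time sensor s t0) D"
    and "\<And>n. 1 \<le> n \<Longrightarrow> K n \<noteq> {} \<and> compact (K n)"
    and "(\<lambda>n. infdist s (K n)) \<longlonglongrightarrow> 0"
    and "(\<Union>n\<in>{1..}. K n) \<subseteq> A"
    and "s \<in> A"
    and "bounded A" and "diameter A \<le> r"
    and "SDN D s A"
    and "0 < r"
    and "\<And>n k. 1 \<le> n \<Longrightarrow> 1 \<le> k \<Longrightarrow>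
      neighborhood_cover (r / 2 ^ k) (K n) {1..m n k} (\<lambda>j. cball (c n k j) (radius r k))"
    and "\<And>n k j. 1 \<le> n \<Longrightarrow> 1 \<le> k \<Longrightarrow> j \<in> {1..m n k} \<Longrightarrow> c n k j \<in> K n"
    and "alg_run (selected D r m c) R"
  shows "(\<forall>j\<ge>1. finite {i. alg_term R (Suc i) j \<noteq> alg_term R i j}) \<and>
    (\<exists>x. (\<forall>j\<ge>1. \<forall>\<^sub>F i in sequentially. alg_term R i j = Some (x j)) \<and> x \<longlonglongrightarrow> s)"
proof -
  let ?S = "selected D r m c"
  note D_le = defect_le[OF assms(1,4)]
  have S_ne: "?S n k \<noteq> {}" if nk: "1 \<le> n" "1 \<le> k" "infdist s (K n) \<le> r / 2 ^ k" for n k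
  proof -
    obtain j where j: "j \<in> {1..m n k}" "s \<in> cball (c n k j) (radius r k)"
      using assms(13)[OF nk(1,2)] nk(3) unfolding neighborhood_cover_def by blast
    then have "D (c n k j) \<le> 2 * radius r k"
      using D_le[of "c n k j"] by simp
    with j(1) show ?thesis by (auto simp: selected_def)
  qed
  have S_ev: "\<forall>\<^sub>F n in sequentially. ?S n k \<noteq> {}" if "1 \<le> k" for k
  proof -
    have "\<forall>\<^sub>F n in sequentially. infdist s (K n) < r / 2 ^ k"
      using assms(6,12) by (simp add: order_tendstoD(2))
    then show ?thesis
      using eventually_ge_at_top[of 1] by eventually_elim (use S_ne that in auto)
  qed
  \<comment> \<open>In early stages \<open>s\<close> may be far from \<open>K n\<close>, so the
    diameter is used instead: \<open>radius r 1 = r\<close>, and every center lies in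
    \<open>A\<close>, hence within \<open>r\<close> of \<open>s\<close>. A point of
    \<open>K n\<close> serves only to show that the cover has a member.\<close>
  have S1: "?S n 1 \<noteq> {}" if n: "1 \<le> n" for n
  proof -
    obtain x where "x \<in> K n"
      using assms(5)[OF n] by blast
    then have "infdist x (K n) \<le> r / 2 ^ 1"
      using assms(12) by simp
    then obtain j where j: "j \<in> {1..m n 1}"
      using assms(13)[OF n, of 1] unfolding neighborhood_cover_def by blast
    have "c n 1 j \<in> A"
      using assms(14)[OF n _ j] assms(7) n by auto
    then have "dist (c n 1 j) s \<le> r"
      using diameter_bounded_bound[OF assms(9) _ assms(8)] assms(10) by fastforce
    then have "D (c n 1 j) \<le> 2 * radius r 1"
      using D_le[of "c n 1 j"] by (simp add: radius_def)
    with j show ?thesis by (auto simp: selected_def)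
  qed
  obtain x where x: "\<And>j. 1 \<le> j \<Longrightarrow> \<forall>\<^sub>F i in sequentially. alg_term R i j = Some (x j)"
    and x_S: "\<And>k. \<forall>\<^sub>F j in sequentially. \<exists>n\<ge>1. \<exists>l\<ge>k. 1 \<le> l \<and> x j \<in> ?S n l"
    using alg_run_limit[OF assms(15) S1 S_ev] by blast
  have radius_lim: "radius r \<longlonglongrightarrow> 0"
  proof -
    have "(\<lambda>k. r * (1 / 2) ^ k) \<longlonglongrightarrow> r * 0"
      by (intro tendsto_mult_left LIMSEQ_realpow_zero) auto
    \<comment> \<open>Passing to \<open>Suc k\<close> removes the truncated subtraction in
      \<open>radius\<close>.\<close>
    then have "(\<lambda>k. radius r (Suc k)) \<longlonglongrightarrow> 0"
      by (simp add: radius_def power_one_over)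
    then show ?thesis by (simp only: filterlim_sequentially_Suc)
  qed
  have "\<forall>\<^sub>F j in sequentially. x j \<in> A"
    using x_S[of 1]
  proof eventually_elim
    case (elim j)
    then obtain n l i where "1 \<le> n" "1 \<le> l" "i \<in> {1..m n l}" "x j = c n l i"
      by (auto simp: selected_def)
    with assms(7) assms(14)[of n l i] show ?case by auto
  qed
  moreover have "\<forall>\<^sub>F j in sequentially. D (x j) < \<epsilon>" if "0 < \<epsilon>" for \<epsilon>
  proof -
    \<comment> \<open>The half compensates the factor 2 in the selection test.\<close>
    have "\<forall>\<^sub>F k in sequentially. radius r k < \<epsilon> / 2"
      using order_tendstoD(2)[OF radius_lim, of "\<epsilon> / 2"] that by simp
    then obtain k where k: "\<And>l. k \<le> l \<Longrightarrow> radius r l < \<epsilon> / 2"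
      by (auto simp: eventually_sequentially)
    show ?thesis
      using x_S[of k]
    proof eventually_elim
      case (elim j)
      then obtain n l where l: "k \<le> l" "x j \<in> ?S n l"
        by blast
      from l(2) have "D (x j) \<le> 2 * radius r l"
        by (auto simp: selected_def)
      with k[OF l(1)] show ?case by simp
    qed
  qed
  ultimately have "x \<longlonglongrightarrow> s"
    by (rule SDN_imp_tendsto[OF assms(11,8)])
  moreover have "finite {i. alg_term R (Suc i) j \<noteq> alg_term R i j}" if "1 \<le> j" for j
    using x[OF that] by (rule finite_changes_if_eventually_const)
  ultimately show ?thesis
    using x by blast
qed

end
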